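(* Let $\mathcal B$ be a Muckenhoupt basis in $\mathbf R^n$, let $\vec P=(p_1,\dots,p_m)$ with $1<p_1,\dots,p_m<\infty$, and let $\frac1p=\frac1{p_1}+\cdots+\frac1{p_m}$. Let $\nu,w_1,\dots,w_m$ be weights associated with $\mathcal B$ such that $(\nu,\vec w)$, $\vec w=(w_1,\dots,w_m)$, satisfies the power bump $A_{\vec P,\mathcal B}$ condition; that is, $\nu\in A_{\infty,\mathcal B}$ and for some $r>1$ $$\sup_{B\in\mathcal B}\Big(\frac1{|B|}\int_B\nu\,dx\Big)\prod_{j=1}^m\Big(\frac1{|B|}\int_B w_j^{(1-p_j')r}\,dx\Big)^{\frac{p}{p_j'r}}<\infty .$$ Then $\mathcal M_{\mathcal B}$ is bounded $$\mathcal M_{\mathcal B}:\ L^{p_1}(w_1)\times\cdots\times L^{p_m}(w_m)\to L^{p,\infty}(\nu).$$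
   Context: A basis $\mathcal B$ in $\mathbf R^n$ is a collection of open sets (nonempty and of finite Lebesgue measure, so that averages make sense). A weight associated with $\mathcal B$ is a non-negative measurable function $w$ on $\mathbf R^n$ with $w(B)=\int_B w\,dx<\infty$ for each $B\in\mathcal B$. The maximal operators are $$M_{\mathcal B}f(x)=\sup_{B\ni x,\,B\in\mathcal B}\frac1{|B|}\int_B|f|\,dy,\qquad \mathcal M_{\mathcal B}(f_1,\dots,f_m)(x)=\sup_{B\ni x,\,B\in\mathcal B}\prod_{i=1}^m\Big(\frac1{|B|}\int_B|f_i|\,dy\Big)$$ for $x\in\bigcup_{B\in\mathcal B}B$, and both are $0$ for other $x$. For $1<q<\infty$, a weight $w$ associated with $\mathcal B$ is in $A_{q,\mathcal B}$ if $\sup_{B\in\mathcal B}\big(\frac1{|B|}\int_B w\big)\big(\frac1{|B|}\int_B w^{1-q'}\big)^{q/q'}<\infty$, with $1/q+1/q'=1$; $A_{\infty,\mathcal B}=\bigcup_{q>1}A_{q,\mathcal B}$. $\mathcal B$ is a Muckenhoupt basis if for every $1<q<\infty$ and every $w\in A_{q,\mathcal B}$ the operator $M_{\mathcal B}$ is bounded from $L^q(w)$ to $L^q(w)$. Boundedness into $L^{p,\infty}(\nu)$ means that there is a constant $C$ such that $\sup_{\lambda>0}\lambda\,\nu(\{\mathcal M_{\mathcal B}(\vec f\,)>\lambda\})^{1/p}\le C\prod_{i=1}^m\big(\int|f_i|^{p_i}w_i\,dx\big)^{1/p_i}$ for all $f_i\in L^{p_i}(w_i)$. Products $0\cdot\infty$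 are interpreted as $0$. *)

theory Defs
  imports "HOL-Analysis.Analysis"
begin

text \<open>The value at infinity and, for negative exponents, at zero are the limits;
  in particular a negative power of a weight is infinite where the weight vanishes.
  Together with the convention \<open>0 * \<infinity> = 0\<close> of \<^typ>\<open>ennreal\<close> this is how all
  expressions below are read.\<close>

definition enn_powr :: "ennreal \<Rightarrow> real \<Rightarrow> ennreal" where
  "enn_powr x a =
     (if a = 0 then 1
      else if x = 0 then (if a < 0 then \<infinity> else 0)
      else if x = \<infinity> then (if a < 0 then 0 else \<infinity>)
      else ennreal (enn2real x powr a))"

definition avg :: "(real ^ 'n) set \<Rightarrow> (real ^ 'n \<Rightarrow> ennreal) \<Rightarrow> ennreal" where
  "avg B g = (\<integral>\<^sup>+x\<in>B. g x \<partial>lebesgue) / emeasure lebesgue B"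

definition conj_exp :: "real \<Rightarrow> real" where
  "conj_exp q = q / (q - 1)"

lemma conj_exp_eq:
  assumes "1 < q"
  shows "1 / q + 1 / conj_exp q = 1"
  using assms by (simp add: conj_exp_def field_simps)

definition basis_of_sets :: "(real ^ 'n) set set \<Rightarrow> bool" where
  "basis_of_sets \<B> \<longleftrightarrow>
     (\<forall>B\<in>\<B>. open B \<and> B \<noteq> {} \<and> emeasure lebesgue B < \<infinity>)"

definition weight_measure :: "(real ^ 'n \<Rightarrow> real) \<Rightarrow> (real ^ 'n) set \<Rightarrow> ennreal" where
  "weight_measure w E = (\<integral>\<^sup>+x\<in>E. ennreal (w x) \<partial>lebesgue)"

definition weight :: "(real ^ 'n) set set \<Rightarrow> (real ^ 'n \<Rightarrow> real) \<Rightarrow> bool" where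
  "weight \<B> w \<longleftrightarrow>
     w \<in> borel_measurable lebesgue \<and> (\<forall>x. 0 \<le> w x) \<and>
     (\<forall>B\<in>\<B>. weight_measure w B < \<infinity>)"

definition wnorm :: "real \<Rightarrow> (real ^ 'n \<Rightarrow> real) \<Rightarrow> (real ^ 'n \<Rightarrow> ennreal) \<Rightarrow> ennreal" where
  "wnorm q w g = enn_powr (\<integral>\<^sup>+x. enn_powr (g x) q * ennreal (w x) \<partial>lebesgue) (1 / q)"

definition weighted_Lp :: "real \<Rightarrow> (real ^ 'n \<Rightarrow> real) \<Rightarrow> (real ^ 'n \<Rightarrow> real) set" where
  "weighted_Lp q w =
     {f \<in> borel_measurable lebesgue. wnorm q w (\<lambda>x. ennreal \<bar>f x\<bar>) < \<infinity>}"

text \<open>For a point outside all sets of the basis the supremum is over the empty set,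
  hence \<open>0\<close> in \<^typ>\<open>ennreal\<close>, as required.\<close>

definition maximal :: "(real ^ 'n) set set \<Rightarrow> (real ^ 'n \<Rightarrow> real) \<Rightarrow> real ^ 'n \<Rightarrow> ennreal" where
  "maximal \<B> f x = (SUP B\<in>{B\<in>\<B>. x \<in> B}. avg B (\<lambda>y. ennreal \<bar>f y\<bar>))"

definition multi_maximal ::
    "(real ^ 'n) set set \<Rightarrow> nat \<Rightarrow> (nat \<Rightarrow> real ^ 'n \<Rightarrow> real) \<Rightarrow> real ^ 'n \<Rightarrow> ennreal" where
  "multi_maximal \<B> m f x =
     (SUP B\<in>{B\<in>\<B>. x \<in> B}. \<Prod>i=1..m. avg B (\<lambda>y. ennreal \<bar>f i y\<bar>))"

definition A_class :: "real \<Rightarrow> (real ^ 'n) set set \<Rightarrow> (real ^ 'n \<Rightarrow> real) set" where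
  "A_class q \<B> =
     {w. weight \<B> w \<and>
         (SUP B\<in>\<B>. avg B (\<lambda>x. ennreal (w x)) *
            enn_powr (avg B (\<lambda>x. enn_powr (ennreal (w x)) (1 - conj_exp q))) (q / conj_exp q))
         < \<infinity>}"

definition A_infinity :: "(real ^ 'n) set set \<Rightarrow> (real ^ 'n \<Rightarrow> real) set" where
  "A_infinity \<B> = (\<Union>q\<in>{1<..}. A_class q \<B>)"

definition maximal_bounded :: "(real ^ 'n) set set \<Rightarrow> real \<Rightarrow> (real ^ 'n \<Rightarrow> real) \<Rightarrow> bool" where
  "maximal_bounded \<B> q w \<longleftrightarrow>
     (\<exists>C::real. \<forall>f\<in>weighted_Lp q w.
        wnorm q w (maximal \<B> f) \<le> ennreal C * wnorm q w (\<lambda>x. ennreal \<bar>f x\<bar>))"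

definition muckenhoupt_basis :: "(real ^ 'n) set set \<Rightarrow> bool" where
  "muckenhoupt_basis \<B> \<longleftrightarrow>
     basis_of_sets \<B> \<and> (\<forall>q>1. \<forall>w\<in>A_class q \<B>. maximal_bounded \<B> q w)"

definition power_bump ::
    "(real ^ 'n) set set \<Rightarrow> nat \<Rightarrow> (nat \<Rightarrow> real) \<Rightarrow> real \<Rightarrow>
     (real ^ 'n \<Rightarrow> real) \<Rightarrow> (nat \<Rightarrow> real ^ 'n \<Rightarrow> real) \<Rightarrow> bool" where
  "power_bump \<B> m P p \<nu> w \<longleftrightarrow>
     \<nu> \<in> A_infinity \<B> \<and>
     (\<exists>r>1. (SUP B\<in>\<B>. avg B (\<lambda>x. ennreal (\<nu> x)) *
        (\<Prod>j=1..m. enn_powr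
           (avg B (\<lambda>x. enn_powr (ennreal (w j x)) ((1 - conj_exp (P j)) * r)))
           (p / (conj_exp (P j) * r)))) < \<infinity>)"

definition multi_maximal_weak_bounded ::
    "(real ^ 'n) set set \<Rightarrow> nat \<Rightarrow> (nat \<Rightarrow> real) \<Rightarrow> real \<Rightarrow>
     (real ^ 'n \<Rightarrow> real) \<Rightarrow> (nat \<Rightarrow> real ^ 'n \<Rightarrow> real) \<Rightarrow> bool" where
  "multi_maximal_weak_bounded \<B> m P p \<nu> w \<longleftrightarrow>
     (\<exists>C::real. \<forall>f. (\<forall>i\<in>{1..m}. f i \<in> weighted_Lp (P i) (w i)) \<longrightarrow>
        (SUP t\<in>{0<..}. ennreal t *
           enn_powr (weight_measure \<nu> {x. ennreal t < multi_maximal \<B> m f x}) (1 / p))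
        \<le> ennreal C * (\<Prod>i=1..m. wnorm (P i) (w i) (\<lambda>x. ennreal \<bar>f i x\<bar>)))"

end

theory Submission
  imports Defs
begin

text \<open>Fix \<open>t > 0\<close>. The level set of the multilinear maximal function is the union of the sets \<open>B\<close> of
  the basis on which the product of the averages of the \<open>f i\<close> exceeds \<open>t\<close>; by the Lindelof property
  and monotone limits it is enough to treat finitely many of them. A greedy choice extracts sets whose parts \<open>E B \<subseteq> B\<close> outside the
  previously chosen ones are disjoint and carry at least half of \<open>B\<close>, while at least half of every
  discarded set is covered. Boundedness of the maximal operator on \<open>L\<^sup>q(\<nu>)\<close> shows
  that the chosen sets carry a fixed fraction of the \<open>\<nu>\<close>-measure. On each chosen \<open>B\<close>, Hoelder's
  inequality with the conjugate exponents \<open>s i\<close> and \<open>conj_exp (P i) * r\<close> together with the bump condition bounds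
  \<open>t\<^sup>p \<nu>(B)\<close> by \<open>\<bar>B\<bar>\<close> times a product of powers of averages of
  \<open>g i = \<bar>f i\<bar> powr s i * w i powr (s i / P i)\<close>, hence by the integral over \<open>E B\<close> of powers of the maximal functions
  of the \<open>g i\<close>. Summation, Hoelder's inequality for \<open>m\<close> functions and the unweighted
  bound for the maximal operator with exponent \<open>P i / s i > 1\<close> conclude.\<close>

section \<open>Powers of extended nonnegative reals\<close>

lemma enn_powr_0_right [simp]: "enn_powr x 0 = 1"
  by (simp add: enn_powr_def)

lemma enn_powr_0_left: "0 < a \<Longrightarrow> enn_powr 0 a = 0"
  by (simp add: enn_powr_def)

lemma enn_powr_0_left_neg: "a < 0 \<Longrightarrow> enn_powr 0 a = top"
  by (simp add: enn_powr_def)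

lemma enn_powr_1_right [simp]: "enn_powr x 1 = x"
  by (cases x) (auto simp: enn_powr_def)

lemma enn_powr_1_left [simp]: "enn_powr 1 a = 1"
  by (simp add: enn_powr_def)

lemma enn_powr_ennreal: "0 < x \<Longrightarrow> enn_powr (ennreal x) a = ennreal (x powr a)"
  by (simp add: enn_powr_def)

lemma enn_powr_ennreal_nonneg: "0 \<le> x \<Longrightarrow> 0 < a \<Longrightarrow> enn_powr (ennreal x) a = ennreal (x powr a)"
  by (cases "x = 0") (auto simp: enn_powr_def)

lemma enn_powr_top: "0 < a \<Longrightarrow> enn_powr top a = top"
  by (simp add: enn_powr_def)

lemma enn_powr_eq_0_iff: "0 < a \<Longrightarrow> enn_powr x a = 0 \<longleftrightarrow> x = 0"
  by (cases x) (auto simp: enn_powr_def)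

lemma enn_powr_eq_top_iff: "0 < a \<Longrightarrow> enn_powr x a = top \<longleftrightarrow> x = top"
  by (cases x) (auto simp: enn_powr_def)

lemma enn_powr_powr: "enn_powr (enn_powr x a) b = enn_powr x (a * b)"
proof (cases x)
  case (real r)
  then show ?thesis
    by (cases "r = 0") (auto simp: enn_powr_def powr_powr mult_less_0_iff zero_less_mult_iff)
next
  case top
  then show ?thesis
    by (auto simp: enn_powr_def mult_less_0_iff zero_less_mult_iff)
qed

text \<open>The exponent must not be negative: for \<open>x = 0\<close>,
  \<open>y = \<infinity>\<close> and \<open>a < 0\<close> the left side is infinite, while the right
  side is \<open>\<infinity> * 0 = 0\<close>.\<close>

lemma enn_powr_mult:
  assumes "0 \<le> a"
  shows "enn_powr (x * y) a = enn_powr x a * enn_powr y a"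
proof (cases "a = 0 \<or> x = 0 \<or> y = 0")
  case True
  then show ?thesis using assms by (cases "a = 0") (auto simp: enn_powr_0_left)
next
  case False
  then have a: "0 < a" using assms by simp
  show ?thesis
  proof (cases "x = \<infinity> \<or> y = \<infinity>")
    case True
    with False a show ?thesis
      by (auto simp: enn_powr_top ennreal_top_mult ennreal_mult_top enn_powr_eq_0_iff)
  next
    case fin: False
    then obtain u v where "x = ennreal u" "y = ennreal v" "0 < u" "0 < v"
      using False by (cases x; cases y) (auto simp: less_le)
    then show ?thesis
      by (simp add: enn_powr_ennreal powr_mult flip: ennreal_mult)
  qed
qed

lemma enn_powr_prod:
  assumes "0 \<le> a"
  shows "enn_powr (\<Prod>i\<in>I. x i) a = (\<Prod>i\<in>I. enn_powr (x i) a)"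
  by (induction I rule: infinite_finite_induct) (auto simp: enn_powr_mult assms)

lemma enn_powr_mono:
  assumes "0 \<le> a" "x \<le> y"
  shows "enn_powr x a \<le> enn_powr y a"
proof (cases "y = \<infinity> \<or> x = 0 \<or> a = 0")
  case True
  then show ?thesis using assms by (auto simp: enn_powr_def)
next
  case False
  with assms obtain u v where "x = ennreal u" "y = ennreal v" "0 < u" "u \<le> v"
    by (cases x; cases y) (auto simp: less_le top_unique)
  then show ?thesis using assms
    by (simp add: enn_powr_ennreal powr_mono2)
qed

lemma enn_powr_measurable [measurable]:
  assumes [measurable]: "f \<in> borel_measurable M"
  shows "(\<lambda>x. enn_powr (f x) a) \<in> borel_measurable M"
  unfolding enn_powr_def by measurable

section \<open>Hoelder's inequality for finitely many functions\<close>

text \<open>For positive finite values this is Jensen's inequality for the concave function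
  \<open>ln\<close>. An infinite value makes the sum infinite; a zero value makes the product zero,
  even next to an infinite factor.\<close>

lemma weighted_arith_geo_mean_ennreal:
  assumes "finite I" "\<And>i. i \<in> I \<Longrightarrow> 0 < a i" "(\<Sum>i\<in>I. a i) = 1"
  shows "(\<Prod>i\<in>I. enn_powr (x i) (a i)) \<le> (\<Sum>i\<in>I. ennreal (a i) * x i)"
proof (cases "(\<exists>i\<in>I. x i = \<infinity>) \<or> (\<exists>i\<in>I. x i = 0)")
  case True
  then show ?thesis
  proof
    assume "\<exists>i\<in>I. x i = \<infinity>"
    then obtain i where i: "i \<in> I" "x i = \<infinity>" by auto
    then have "ennreal (a i) * x i = \<infinity>"
      using assms(2)[of i] by (simp add: ennreal_mult_top)
    then have "(\<Sum>i\<in>I. ennreal (a i) * x i) = \<infinity>"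
      using i(1) assms(1) by (auto simp: ennreal_mult_eq_top_iff)
    then show ?thesis by simp
  next
    assume "\<exists>i\<in>I. x i = 0"
    then obtain i where i: "i \<in> I" "x i = 0" by auto
    then have "enn_powr (x i) (a i) = 0"
      using assms(2)[of i] by (simp add: enn_powr_0_left)
    then have "(\<Prod>i\<in>I. enn_powr (x i) (a i)) = 0"
      using i(1) assms(1) by auto
    then show ?thesis by (simp only: zero_le)
  qed
next
  case False
  define y where "y i = enn2real (x i)" for i
  have y: "x i = ennreal (y i)" "0 < y i" if "i \<in> I" for i
    using False that by (cases "x i"; auto simp: y_def less_le)+
  have "I \<noteq> {}" using assms(3) by auto
  have "(\<Sum>i\<in>I. a i * ln (y i)) \<le> ln (\<Sum>i\<in>I. a i * y i)"
    using concave_on_sum[OF assms(1) \<open>I \<noteq> {}\<close> ln_concave, of a y] assms y by (auto simp: less_imp_le)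
  moreover have pos: "0 < (\<Sum>i\<in>I. a i * y i)"
    using assms y \<open>I \<noteq> {}\<close> by (intro sum_pos) auto
  ultimately have "exp (\<Sum>i\<in>I. a i * ln (y i)) \<le> (\<Sum>i\<in>I. a i * y i)"
    by (metis exp_le_cancel_iff exp_ln)
  moreover have "exp (\<Sum>i\<in>I. a i * ln (y i)) = (\<Prod>i\<in>I. y i powr a i)"
    using y assms(1) by (force simp: exp_sum powr_def intro!: prod.cong)
  ultimately have "ennreal (\<Prod>i\<in>I. y i powr a i) \<le> ennreal (\<Sum>i\<in>I. a i * y i)"
    by (simp add: ennreal_leI)
  moreover have "(\<Prod>i\<in>I. enn_powr (x i) (a i)) = ennreal (\<Prod>i\<in>I. y i powr a i)"
    using y by (subst prod_ennreal[symmetric]) (auto simp: enn_powr_ennreal intro!: prod.cong)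
  moreover have "(\<Sum>i\<in>I. ennreal (a i) * x i) = ennreal (\<Sum>i\<in>I. a i * y i)"
    using y assms(2) by (subst sum_ennreal[symmetric])
      (auto simp: ennreal_mult less_imp_le intro!: sum.cong)
  ultimately show ?thesis by simp
qed

text \<open>After each \<open>F i\<close> is scaled to integral one, the pointwise weighted mean
  inequality integrates to the claim. If some integral is zero, the product vanishes almost
  everywhere; if none is zero but one is infinite, the right side is infinite.\<close>

lemma nn_integral_Holder_prod:
  assumes I: "finite I" "\<And>i. i \<in> I \<Longrightarrow> 0 < a i" "(\<Sum>i\<in>I. a i) = 1"
    and F [measurable]: "\<And>i. i \<in> I \<Longrightarrow> F i \<in> borel_measurable M"
  shows "(\<integral>\<^sup>+x. (\<Prod>i\<in>I. enn_powr (F i x) (a i)) \<partial>M) \<le> (\<Prod>i\<in>I. enn_powr (\<integral>\<^sup>+x. F i x \<partial>M) (a i))"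
proof (cases "\<exists>i\<in>I. (\<integral>\<^sup>+x. F i x \<partial>M) = 0")
  case True
  then obtain i where i: "i \<in> I" "(\<integral>\<^sup>+x. F i x \<partial>M) = 0" by auto
  then have "AE x in M. F i x = 0" by (subst (asm) nn_integral_0_iff_AE) auto
  then have "AE x in M. (\<Prod>i\<in>I. enn_powr (F i x) (a i)) = 0"
  proof eventually_elim
    case (elim x)
    then have "enn_powr (F i x) (a i) = 0"
      using I(2) i(1) by (simp add: enn_powr_0_left)
    then show ?case using i(1) I(1) by auto
  qed
  then have "(\<integral>\<^sup>+x. (\<Prod>i\<in>I. enn_powr (F i x) (a i)) \<partial>M) = 0"
    by (subst nn_integral_0_iff_AE) auto
  then show ?thesis by simp
next
  case nz: False
  show ?thesis
  proof (cases "\<exists>i\<in>I. (\<integral>\<^sup>+x. F i x \<partial>M) = \<infinity>")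
    case True
    have "(\<Prod>i\<in>I. enn_powr (\<integral>\<^sup>+x. F i x \<partial>M) (a i)) = top"
      using True nz I unfolding ennreal_prod_eq_top
      by (metis enn_powr_eq_0_iff enn_powr_top infinity_ennreal_def)
    then show ?thesis by simp
  next
    case fin: False
    define y where "y i = enn2real (\<integral>\<^sup>+x. F i x \<partial>M)" for i
    have y: "(\<integral>\<^sup>+x. F i x \<partial>M) = ennreal (y i)" "0 < y i" if "i \<in> I" for i
      using nz fin that by (cases "\<integral>\<^sup>+x. F i x \<partial>M"; auto simp: y_def less_le)+
    define G where "G i x = ennreal (1 / y i) * F i x" for i x
    have G [measurable]: "\<And>i. i \<in> I \<Longrightarrow> G i \<in> borel_measurable M"
      unfolding G_def by measurable
    have FG: "F i x = ennreal (y i) * G i x" if "i \<in> I" for i x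
      using y(2)[OF that] unfolding G_def mult.assoc[symmetric]
      by (simp add: ennreal_mult[symmetric])
    have intG: "(\<integral>\<^sup>+x. G i x \<partial>M) = 1" if "i \<in> I" for i
      unfolding G_def using y[OF that] that
      by (subst nn_integral_cmult) (auto simp: ennreal_mult[symmetric])
    have "(\<integral>\<^sup>+x. (\<Prod>i\<in>I. enn_powr (F i x) (a i)) \<partial>M)
        = (\<integral>\<^sup>+x. (\<Prod>i\<in>I. enn_powr (ennreal (y i)) (a i)) * (\<Prod>i\<in>I. enn_powr (G i x) (a i)) \<partial>M)"
      using I(2) by (auto simp: FG enn_powr_mult less_imp_le prod.distrib[symmetric]
          intro!: nn_integral_cong prod.cong)
    also have "\<dots> = (\<Prod>i\<in>I. enn_powr (ennreal (y i)) (a i)) * (\<integral>\<^sup>+x. (\<Prod>i\<in>I. enn_powr (G i x) (a i)) \<partial>M)"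
      by (intro nn_integral_cmult) measurable
    also have "(\<integral>\<^sup>+x. (\<Prod>i\<in>I. enn_powr (G i x) (a i)) \<partial>M) \<le> (\<integral>\<^sup>+x. (\<Sum>i\<in>I. ennreal (a i) * G i x) \<partial>M)"
      using I by (intro nn_integral_mono weighted_arith_geo_mean_ennreal) auto
    also have "\<dots> = (\<Sum>i\<in>I. ennreal (a i) * (\<integral>\<^sup>+x. G i x \<partial>M))"
      by (subst nn_integral_sum) (auto intro!: sum.cong nn_integral_cmult)
    also have "\<dots> = (\<Sum>i\<in>I. ennreal (a i))"
      by (intro sum.cong) (auto simp: intG)
    also have "\<dots> = 1"
      using I by (subst sum_ennreal) (auto simp: less_imp_le)
    finally show ?thesis
      using y by (auto simp: mult_left_mono cong: prod.cong)
  qed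
qed

lemma nn_integral_Holder:
  assumes "1 < s" and [measurable]: "u \<in> borel_measurable M" "v \<in> borel_measurable M"
  shows "(\<integral>\<^sup>+x. u x * v x \<partial>M) \<le>
    enn_powr (\<integral>\<^sup>+x. enn_powr (u x) s \<partial>M) (1 / s) *
    enn_powr (\<integral>\<^sup>+x. enn_powr (v x) (conj_exp s) \<partial>M) (1 / conj_exp s)"
proof -
  have s: "0 < s" "0 < conj_exp s" using assms(1) by (auto simp: conj_exp_def)
  \<comment> \<open>The inequality for finitely many functions is applied with the two booleans as
    index set.\<close>
  define F where "F b x = (if b then enn_powr (u x) s else enn_powr (v x) (conj_exp s))" for b x
  define a where "a b = (if b then 1 / s else 1 / conj_exp s)" for b
  have "(\<integral>\<^sup>+x. (\<Prod>i\<in>UNIV. enn_powr (F i x) (a i)) \<partial>M) \<le> (\<Prod>i\<in>UNIV. enn_powr (\<integral>\<^sup>+x. F i x \<partial>M) (a i))"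
    using s conj_exp_eq[OF assms(1)]
    by (intro nn_integral_Holder_prod) (auto simp: F_def a_def UNIV_bool)
  then show ?thesis
    using s by (simp add: F_def a_def UNIV_bool enn_powr_powr mult.commute)
qed

section \<open>Sparse selection from a finite family\<close>

text \<open>The greedy choice is the induction itself: a new set \<open>A\<close> is discarded if at
  least half of it is already covered by the chosen sets. Otherwise it is chosen, and its uncovered
  part, which carries more than half of it, becomes \<open>E A\<close>.\<close>

lemma sparse_selection:
  assumes "finite F" "F \<subseteq> sets M" "\<forall>B\<in>F. emeasure M B < \<infinity>"
  shows "\<exists>F' E. F' \<subseteq> F \<and> disjoint_family_on E F' \<and>
    (\<forall>B\<in>F'. E B \<in> sets M \<and> E B \<subseteq> B \<and> emeasure M B \<le> 2 * emeasure M (E B)) \<and>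
    (\<forall>B\<in>F. emeasure M B \<le> 2 * emeasure M (B \<inter> \<Union>F'))"
  using assms
proof (induction F rule: finite_induct)
  case empty
  then show ?case by (auto simp: disjoint_family_on_def)
next
  case (insert A F)
  then obtain F' E where F': "F' \<subseteq> F" "disjoint_family_on E F'"
    and E: "\<And>B. B \<in> F' \<Longrightarrow> E B \<in> sets M" "\<And>B. B \<in> F' \<Longrightarrow> E B \<subseteq> B"
      "\<And>B. B \<in> F' \<Longrightarrow> emeasure M B \<le> 2 * emeasure M (E B)"
    and F: "\<And>B. B \<in> F \<Longrightarrow> emeasure M B \<le> 2 * emeasure M (B \<inter> \<Union>F')"
    by auto
  let ?U = "\<Union>F'"
  have sets: "A \<in> sets M" "\<And>B. B \<in> F' \<Longrightarrow> B \<in> sets M" "\<And>B. B \<in> F \<Longrightarrow> B \<in> sets M"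
    using insert.prems F'(1) by auto
  have U: "?U \<in> sets M"
    using sets(2) finite_subset[OF F'(1) insert.hyps(1)] by auto
  show ?case
  proof (cases "emeasure M A \<le> 2 * emeasure M (A \<inter> ?U)")
    case True
    then show ?thesis using F' E F by (intro exI[of _ F'] exI[of _ E]) auto
  next
    case False
    \<comment> \<open>A member of \<open>F'\<close> would be covered entirely. Hence redefining
      \<open>E\<close> at \<open>A\<close> leaves the earlier choices unchanged.\<close>
    then have "A \<notin> F'" using sets(1) by (auto simp: Int_absorb2 Sup_upper mult_2)
    define E' where "E' = E(A := A - ?U)"
    have E': "E' B = E B" if "B \<in> F'" for B
      using that \<open>A \<notin> F'\<close> by (auto simp: E'_def)
    have split: "emeasure M A = emeasure M (A \<inter> ?U) + emeasure M (A - ?U)"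
      using sets(1) U by (metis Int_Diff_Un Int_Diff_disjoint plus_emeasure sets.Diff sets.Int)
    have "emeasure M A < \<infinity>" using insert.prems by auto
    then obtain c d where cd: "emeasure M (A \<inter> ?U) = ennreal c" "emeasure M (A - ?U) = ennreal d"
      "0 \<le> c" "0 \<le> d"
      unfolding split by (cases "emeasure M (A \<inter> ?U)"; cases "emeasure M (A - ?U)") auto
    \<comment> \<open>Thus \<open>c < d\<close>: the uncovered part outweighs the covered one, so
      \<open>c + d \<le> 2 * d\<close>.\<close>
    have "2 * c < c + d"
      using False cd unfolding split
      by (auto simp: not_le ennreal_less_iff simp flip: ennreal_plus ennreal_mult ennreal_numeral)
    then have A: "emeasure M A \<le> 2 * emeasure M (E' A)"
      using cd unfolding split E'_def
      by (auto intro!: ennreal_leI simp flip: ennreal_plus ennreal_mult ennreal_numeral)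
    have mono: "emeasure M B \<le> 2 * emeasure M (B \<inter> \<Union>(insert A F'))" if "B \<in> F" for B
    proof -
      have "emeasure M (B \<inter> ?U) \<le> emeasure M (B \<inter> \<Union>(insert A F'))"
        using that sets U by (intro emeasure_mono) auto
      then show ?thesis using F[OF that] by (meson mult_left_mono order_trans zero_le)
    qed
    have "A \<inter> \<Union>(insert A F') = A" by auto
    then have A2: "emeasure M A \<le> 2 * emeasure M (A \<inter> \<Union>(insert A F'))"
      by (simp add: mult_2)
    have "E B \<inter> (A - ?U) = {}" if "B \<in> F'" for B
      using E(2)[OF that] that by auto
    then have "disjoint_family_on E' (insert A F')"
      using F'(2) \<open>A \<notin> F'\<close> unfolding disjoint_family_on_def E'_def by (auto; blast)
    then show ?thesis
      using F'(1) E E' A A2 mono sets U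
      by (intro exI[of _ "insert A F'"] exI[of _ E']) (auto simp: E', auto simp: E'_def)
  qed
qed

section \<open>Averages and measurability of the maximal function\<close>

lemma weight_measure_eq_emeasure:
  assumes "w \<in> borel_measurable lebesgue" "E \<in> sets lebesgue"
  shows "weight_measure w E = emeasure (density lebesgue (\<lambda>x. ennreal (w x))) E"
  unfolding weight_measure_def using assms by (subst emeasure_density) auto

lemma emeasure_basis_pos:
  assumes "open B" "B \<noteq> {}"
  shows "0 < emeasure lebesgue B"
  using open_not_negligible[OF assms] assms(1)
  by (auto simp: negligible_iff_null_sets null_sets_def zero_less_iff_neq_zero)

lemma avg_eq_uniform:
  assumes "g \<in> borel_measurable lebesgue" "B \<in> sets lebesgue"
  shows "avg B g = (\<integral>\<^sup>+x. g x \<partial>uniform_measure lebesgue B)"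
  unfolding avg_def using assms by (subst nn_integral_uniform_measure) auto

lemma avg_Holder:
  assumes "1 < s" and [measurable]: "u \<in> borel_measurable lebesgue" "v \<in> borel_measurable lebesgue"
    "B \<in> sets lebesgue"
  shows "avg B (\<lambda>x. u x * v x) \<le>
    enn_powr (avg B (\<lambda>x. enn_powr (u x) s)) (1 / s) *
    enn_powr (avg B (\<lambda>x. enn_powr (v x) (conj_exp s))) (1 / conj_exp s)"
proof -
  have "u \<in> borel_measurable (uniform_measure lebesgue B)" "v \<in> borel_measurable (uniform_measure lebesgue B)"
    by (simp_all only: measurable_cong_sets[OF sets_uniform_measure refl] assms)
  from nn_integral_Holder[OF assms(1) this] show ?thesis
    by (subst (1 2 3) avg_eq_uniform) simp_all
qed

lemma avg_cong_AE:
  assumes "AE x in lebesgue. x \<in> B \<longrightarrow> g x = h x"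
  shows "avg B g = avg B h"
proof -
  have "(\<integral>\<^sup>+x\<in>B. g x \<partial>lebesgue) = (\<integral>\<^sup>+x\<in>B. h x \<partial>lebesgue)"
    using assms by (intro nn_integral_cong_AE) (auto elim!: eventually_mono simp: indicator_def)
  then show ?thesis by (simp add: avg_def)
qed

text \<open>The supremum at \<open>x\<close> exceeds \<open>t\<close> exactly when one admissible
  set does, and that set then lies wholly in the level set. This serves both the linear and the
  multilinear maximal function.\<close>

lemma SUP_containing_gt:
  fixes c :: "'a set \<Rightarrow> ennreal"
  shows "{x. t < (SUP B\<in>{B\<in>\<B>. x \<in> B}. c B)} = \<Union>{B\<in>\<B>. t < c B}"
  by (auto simp: less_SUP_iff)

text \<open>Every strict superlevel set is a union of open sets, so no countability of the basis is
  involved.\<close>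

lemma maximal_measurable:
  assumes "basis_of_sets \<B>"
  shows "maximal \<B> f \<in> borel_measurable lebesgue"
proof -
  have "maximal \<B> f \<in> borel_measurable borel"
  proof (rule borel_measurableI_greater)
    fix y
    have "open {x. y < maximal \<B> f x}"
      unfolding maximal_def SUP_containing_gt using assms by (auto simp: basis_of_sets_def)
    then show "{x \<in> space borel. y < maximal \<B> f x} \<in> sets borel" by simp
  qed
  then show ?thesis by (intro measurable_completion) simp
qed

section \<open>Consequences of the boundedness of the maximal operator\<close>

text \<open>The factor \<open>q\<close> in the exponent cancels the root in the norm; the cases used
  are \<open>a = 1\<close> and \<open>a = p / P i\<close>.\<close>

lemma wnorm_powr:
  assumes "q \<noteq> 0"
  shows "enn_powr (wnorm q w g) (q * a) = enn_powr (\<integral>\<^sup>+x. enn_powr (g x) q * ennreal (w x) \<partial>lebesgue) a"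
  using assms by (simp add: wnorm_def enn_powr_powr)

lemma maximal_boundedE:
  assumes "maximal_bounded \<B> q w" "0 < q"
  obtains K :: real where "0 < K"
    "\<And>f. f \<in> borel_measurable lebesgue \<Longrightarrow>
      (\<integral>\<^sup>+x. enn_powr (ennreal \<bar>f x\<bar>) q * ennreal (w x) \<partial>lebesgue) < \<infinity> \<Longrightarrow>
      (\<integral>\<^sup>+x. enn_powr (maximal \<B> f x) q * ennreal (w x) \<partial>lebesgue)
      \<le> ennreal K * (\<integral>\<^sup>+x. enn_powr (ennreal \<bar>f x\<bar>) q * ennreal (w x) \<partial>lebesgue)"
proof -
  obtain C :: real where C: "\<And>f. f \<in> weighted_Lp q w \<Longrightarrow>
      wnorm q w (maximal \<B> f) \<le> ennreal C * wnorm q w (\<lambda>x. ennreal \<bar>f x\<bar>)"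
    using assms(1) by (auto simp: maximal_bounded_def)
  \<comment> \<open>The given constant may be zero or negative; enlarging it makes the final
    constant \<open>D powr q\<close> positive.\<close>
  define D where "D = max C 1"
  have "0 < D" by (simp add: D_def)
  have "(\<integral>\<^sup>+x. enn_powr (maximal \<B> f x) q * ennreal (w x) \<partial>lebesgue)
      \<le> ennreal (D powr q) * (\<integral>\<^sup>+x. enn_powr (ennreal \<bar>f x\<bar>) q * ennreal (w x) \<partial>lebesgue)"
    if f: "f \<in> borel_measurable lebesgue"
      "(\<integral>\<^sup>+x. enn_powr (ennreal \<bar>f x\<bar>) q * ennreal (w x) \<partial>lebesgue) < \<infinity>" for f
  proof -
    have "f \<in> weighted_Lp q w"
      using f assms(2) by (auto simp: weighted_Lp_def wnorm_def enn_powr_eq_top_iff simp flip: less_top)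
    then have "wnorm q w (maximal \<B> f) \<le> ennreal D * wnorm q w (\<lambda>x. ennreal \<bar>f x\<bar>)"
      by (rule order_trans[OF C]) (auto simp: D_def intro!: mult_right_mono ennreal_leI)
    then have "enn_powr (wnorm q w (maximal \<B> f)) (q * 1)
        \<le> enn_powr (ennreal D * wnorm q w (\<lambda>x. ennreal \<bar>f x\<bar>)) (q * 1)"
      using assms(2) by (intro enn_powr_mono) auto
    also have "\<dots> = enn_powr (ennreal D) q * enn_powr (wnorm q w (\<lambda>x. ennreal \<bar>f x\<bar>)) (q * 1)"
      using assms(2) by (subst enn_powr_mult) auto
    finally show ?thesis
      using assms(2) \<open>0 < D\<close> by (subst (asm) (1 2) wnorm_powr) (auto simp: enn_powr_ennreal)
  qed
  then show ?thesis using that[of "D powr q"] \<open>0 < D\<close> by auto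
qed

text \<open>The analogue of doubling: a union of sets of the basis, half of each of which lies in
  \<open>G\<close>, is contained in the set where the maximal function of the indicator of \<open>G\<close> is at least
  \<open>1/2\<close>.\<close>

lemma A_infinity_enlarge:
  fixes \<B> :: "(real ^ 'n) set set"
  assumes "muckenhoupt_basis \<B>" "\<nu> \<in> A_infinity \<B>"
  obtains K :: real where "0 < K"
    "\<And>F G. F \<subseteq> \<B> \<Longrightarrow> G \<in> sets lebesgue \<Longrightarrow> weight_measure \<nu> G < \<infinity> \<Longrightarrow>
      (\<And>B. B \<in> F \<Longrightarrow> emeasure lebesgue B \<le> 2 * emeasure lebesgue (B \<inter> G)) \<Longrightarrow>
      weight_measure \<nu> (\<Union>F) \<le> ennreal K * weight_measure \<nu> G"
proof -
  obtain q where q: "1 < q" "\<nu> \<in> A_class q \<B>"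
    using assms(2) by (auto simp: A_infinity_def)
  have basis: "basis_of_sets \<B>" and bdd: "maximal_bounded \<B> q \<nu>"
    using assms(1) q by (auto simp: muckenhoupt_basis_def)
  have [measurable]: "\<nu> \<in> borel_measurable lebesgue"
    using q by (auto simp: A_class_def weight_def)
  note [measurable] = maximal_measurable[OF basis]
  obtain K :: real where K: "0 < K"
    "\<And>f. f \<in> borel_measurable lebesgue \<Longrightarrow>
      (\<integral>\<^sup>+x. enn_powr (ennreal \<bar>f x\<bar>) q * ennreal (\<nu> x) \<partial>lebesgue) < \<infinity> \<Longrightarrow>
      (\<integral>\<^sup>+x. enn_powr (maximal \<B> f x) q * ennreal (\<nu> x) \<partial>lebesgue)
      \<le> ennreal K * (\<integral>\<^sup>+x. enn_powr (ennreal \<bar>f x\<bar>) q * ennreal (\<nu> x) \<partial>lebesgue)"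
    using maximal_boundedE[OF bdd] q(1) by auto
  have "weight_measure \<nu> (\<Union>F) \<le> ennreal (2 powr q * K) * weight_measure \<nu> G"
    if F: "F \<subseteq> \<B>" and G [measurable]: "G \<in> sets lebesgue" and fin: "weight_measure \<nu> G < \<infinity>"
      and half: "\<And>B. B \<in> F \<Longrightarrow> emeasure lebesgue B \<le> 2 * emeasure lebesgue (B \<inter> G)" for F G
  proof -
    define f :: "real ^ 'n \<Rightarrow> real" where "f = indicator G"
    have [measurable]: "f \<in> borel_measurable lebesgue" unfolding f_def by simp
    \<comment> \<open>\<open>F\<close> may be uncountable here, so measurability of the union comes
      from openness.\<close>
    have "open (\<Union>F)" using F basis by (auto simp: basis_of_sets_def)
    then have [measurable]: "\<Union>F \<in> sets lebesgue" by simp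
    have nf: "enn_powr (ennreal \<bar>f x\<bar>) q * ennreal (\<nu> x) = ennreal (\<nu> x) * indicator G x" for x
      using q(1) by (auto simp: f_def indicator_def enn_powr_0_left)
    have max: "ennreal (1 / 2) \<le> maximal \<B> f x" if x: "x \<in> \<Union>F" for x
    proof -
      obtain B where B: "B \<in> F" "x \<in> B" using x by auto
      then have "open B" "B \<noteq> {}" "emeasure lebesgue B < \<infinity>"
        using F basis by (auto simp: basis_of_sets_def)
      note B' = this emeasure_basis_pos[OF this(1,2)]
      have [measurable]: "B \<in> sets lebesgue" using B'(1) by simp
      have "(\<integral>\<^sup>+x\<in>B. ennreal \<bar>f x\<bar> \<partial>lebesgue) = (\<integral>\<^sup>+x. indicator (B \<inter> G) x \<partial>lebesgue)"
        by (intro nn_integral_cong) (auto simp: f_def indicator_def)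
      then have avg: "avg B (\<lambda>x. ennreal \<bar>f x\<bar>) = emeasure lebesgue (B \<inter> G) / emeasure lebesgue B"
        by (simp add: avg_def)
      have "emeasure lebesgue (B \<inter> G) \<le> emeasure lebesgue B"
        by (intro emeasure_mono) auto
      then obtain a b where ab: "emeasure lebesgue (B \<inter> G) = ennreal a" "emeasure lebesgue B = ennreal b"
        "0 \<le> a" "0 < b"
        using B' by (cases "emeasure lebesgue (B \<inter> G)"; cases "emeasure lebesgue B") (auto simp: top_unique)
      have "b \<le> 2 * a"
        using half[OF B(1)] ab by (simp flip: ennreal_mult ennreal_numeral)
      then have "ennreal (1 / 2) \<le> avg B (\<lambda>x. ennreal \<bar>f x\<bar>)"
        using ab unfolding avg by (simp add: divide_ennreal field_simps ennreal_leI del: ennreal_half)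
      also have "\<dots> \<le> maximal \<B> f x"
        unfolding maximal_def using B F by (intro SUP_upper) auto
      finally show ?thesis .
    qed
    \<comment> \<open>Chebyshev's inequality at height \<open>1/2\<close>, followed by the
      strong-type bound for the indicator of \<open>G\<close>. The factor \<open>2 powr q\<close>
      then clears the left side.\<close>
    have "ennreal ((1 / 2) powr q) * weight_measure \<nu> (\<Union>F)
        = (\<integral>\<^sup>+x. ennreal ((1 / 2) powr q) * (ennreal (\<nu> x) * indicator (\<Union>F) x) \<partial>lebesgue)"
      unfolding weight_measure_def by (subst nn_integral_cmult) auto
    also have "\<dots> \<le> (\<integral>\<^sup>+x. enn_powr (maximal \<B> f x) q * ennreal (\<nu> x) \<partial>lebesgue)"
    proof (intro nn_integral_mono)
      fix x
      show "ennreal ((1 / 2) powr q) * (ennreal (\<nu> x) * indicator (\<Union>F) x)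
          \<le> enn_powr (maximal \<B> f x) q * ennreal (\<nu> x)"
      proof (cases "x \<in> \<Union>F")
        case True
        have "ennreal ((1 / 2) powr q) = enn_powr (ennreal (1 / 2)) q"
          by (rule enn_powr_ennreal[symmetric]) simp
        also have "\<dots> \<le> enn_powr (maximal \<B> f x) q"
          using max[OF True] q(1) by (intro enn_powr_mono) auto
        finally show ?thesis using True by (simp add: mult_right_mono)
      qed simp
    qed
    also have "\<dots> \<le> ennreal K * weight_measure \<nu> G"
      using K(2)[of f] fin unfolding nf weight_measure_def by auto
    finally have "ennreal (2 powr q) * (ennreal ((1 / 2) powr q) * weight_measure \<nu> (\<Union>F))
        \<le> ennreal (2 powr q) * (ennreal K * weight_measure \<nu> G)"
      by (rule mult_left_mono) simp
    moreover have "(2::real) powr q * (1 / 2) powr q = 1"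
      by (simp add: powr_mult[symmetric])
    ultimately show ?thesis
      using K(1) by (simp add: mult.assoc[symmetric] ennreal_mult[symmetric])
  qed
  then show ?thesis using that[of "2 powr q * K"] K(1) by auto
qed

text \<open>The constant weight has all averages equal to 1 and so belongs to every
  \<open>A_class q \<B>\<close> with \<open>q > 1\<close>; the Muckenhoupt property then applies to
  it.\<close>

lemma maximal_bounded_unweighted:
  assumes "muckenhoupt_basis \<B>" "1 < q"
  shows "maximal_bounded \<B> q (\<lambda>_. 1)"
proof -
  have "avg B (\<lambda>_. 1) = 1" if "B \<in> \<B>" for B
  proof -
    have B: "open B" "B \<noteq> {}" "emeasure lebesgue B < \<infinity>"
      using that assms(1) by (auto simp: basis_of_sets_def muckenhoupt_basis_def)
    then show ?thesis
      using emeasure_basis_pos[OF B(1,2)] by (simp add: avg_def ennreal_divide_self)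
  qed
  moreover have "weight \<B> (\<lambda>_. 1)"
    using assms(1) by (auto simp: basis_of_sets_def muckenhoupt_basis_def weight_def weight_measure_def)
  ultimately have "(\<lambda>_. 1) \<in> A_class q \<B>"
    by (auto simp: A_class_def cong: SUP_cong) (cases "\<B> = {}"; simp add: bot_ennreal)
  then show ?thesis using assms by (simp add: muckenhoupt_basis_def)
qed

section \<open>Conjugate exponents and the estimate on a single basis set\<close>

lemma conj_exp_gt_1: "1 < q \<Longrightarrow> 1 < conj_exp q"
  by (simp add: conj_exp_def)

lemma conj_exp_conj_exp: "1 < q \<Longrightarrow> conj_exp (conj_exp q) = q"
  by (simp add: conj_exp_def field_simps)

lemma conj_exp_strict_antimono: "1 < a \<Longrightarrow> a < b \<Longrightarrow> conj_exp b < conj_exp a"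
  by (simp add: conj_exp_def field_simps)

lemma one_minus_conj_exp: "1 < q \<Longrightarrow> 1 - conj_exp q = - (conj_exp q / q)"
  by (simp add: conj_exp_def field_simps)

text \<open>Write \<open>\<bar>f\<bar>\<close> as the product of
  \<open>\<bar>f\<bar> * w powr (1 / P)\<close> and \<open>w powr (- 1 / P)\<close>, and apply
  Hoelder with exponents \<open>s\<close> and \<open>conj_exp P * r\<close>. Since
  \<open>1 - conj_exp P = - (conj_exp P / P)\<close>, the second factor yields exactly the bumped
  power of \<open>w\<close>.\<close>

lemma avg_weighted_Holder:
  fixes f w :: "real ^ 'n \<Rightarrow> real"
  assumes "1 < P" "1 < r" and B [measurable]: "B \<in> sets lebesgue" and fin: "emeasure lebesgue B < \<infinity>"
    and [measurable]: "f \<in> borel_measurable lebesgue" "w \<in> borel_measurable lebesgue"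
    and w: "\<And>x. 0 \<le> w x"
    and W: "avg B (\<lambda>x. enn_powr (ennreal (w x)) ((1 - conj_exp P) * r)) < \<infinity>"
    and s: "s = conj_exp (conj_exp P * r)"
  shows "avg B (\<lambda>x. ennreal \<bar>f x\<bar>) \<le>
    enn_powr (avg B (\<lambda>x. ennreal (\<bar>f x\<bar> powr s * w x powr (s / P)))) (1 / s) *
    enn_powr (avg B (\<lambda>x. enn_powr (ennreal (w x)) ((1 - conj_exp P) * r))) (1 / (conj_exp P * r))"
proof -
  have t: "1 < conj_exp P * r"
    using conj_exp_gt_1[OF assms(1)] assms(2) by (simp add: less_1_mult)
  have s1: "1 < s" "conj_exp s = conj_exp P * r"
    using conj_exp_gt_1[OF t] conj_exp_conj_exp[OF t] by (simp_all add: s)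
  have P: "(1 - conj_exp P) * r = - 1 / P * (conj_exp P * r)"
    using one_minus_conj_exp[OF assms(1)] by simp
  have neg: "(1 - conj_exp P) * r < 0"
    using conj_exp_gt_1[OF assms(1)] assms(2) by (simp add: mult_less_0_iff)
  \<comment> \<open>As \<open>B\<close> has finite measure, an infinite integral would give an
    infinite average. The integrand is infinite where \<open>w\<close> vanishes, so \<open>w\<close>
    is positive almost everywhere on \<open>B\<close>, as the splitting of \<open>f\<close>
    requires.\<close>
  have "(\<integral>\<^sup>+x\<in>B. enn_powr (ennreal (w x)) ((1 - conj_exp P) * r) \<partial>lebesgue) \<noteq> \<infinity>"
    using W fin by (auto simp: avg_def ennreal_top_divide split: if_splits)
  then have "AE x in lebesgue. enn_powr (ennreal (w x)) ((1 - conj_exp P) * r) * indicator B x \<noteq> \<infinity>"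
    by (intro nn_integral_PInf_AE) auto
  then have pos: "AE x in lebesgue. x \<in> B \<longrightarrow> 0 < w x"
  proof eventually_elim
    case (elim x)
    show ?case
    proof
      assume "x \<in> B"
      with elim neg show "0 < w x"
        using w[of x] by (cases "w x = 0") (auto simp: enn_powr_0_left_neg)
    qed
  qed
  define u where "u x = ennreal (\<bar>f x\<bar> * w x powr (1 / P))" for x
  define v where "v x = enn_powr (ennreal (w x)) (- 1 / P)" for x
  have [measurable]: "u \<in> borel_measurable lebesgue" "v \<in> borel_measurable lebesgue"
    unfolding u_def v_def by measurable
  have "avg B (\<lambda>x. ennreal \<bar>f x\<bar>) = avg B (\<lambda>x. u x * v x)"
  proof (rule avg_cong_AE, use pos in eventually_elim, rule impI)
    fix x assume "x \<in> B \<longrightarrow> 0 < w x" "x \<in> B"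
    then have "0 < w x" by simp
    then show "ennreal \<bar>f x\<bar> = u x * v x"
      by (simp add: u_def v_def enn_powr_ennreal ennreal_mult[symmetric] powr_add[symmetric] mult.assoc)
  qed
  also have "\<dots> \<le> enn_powr (avg B (\<lambda>x. enn_powr (u x) s)) (1 / s) *
    enn_powr (avg B (\<lambda>x. enn_powr (v x) (conj_exp s))) (1 / conj_exp s)"
    by (intro avg_Holder s1) auto
  also have "(\<lambda>x. enn_powr (u x) s) = (\<lambda>x. ennreal (\<bar>f x\<bar> powr s * w x powr (s / P)))"
    using s1(1) w by (auto simp: u_def enn_powr_ennreal_nonneg powr_mult powr_powr)
  also have "(\<lambda>x. enn_powr (v x) (conj_exp s)) = (\<lambda>x. enn_powr (ennreal (w x)) ((1 - conj_exp P) * r))"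
    unfolding v_def s1(2) enn_powr_powr P ..
  finally show ?thesis by (simp only: s1(2))
qed

text \<open>A weight value is finite, so its negative power is never zero; a vanishing average would
  therefore make \<open>B\<close> a null set.\<close>

lemma avg_neg_power_pos:
  fixes w :: "real ^ 'n \<Rightarrow> real"
  assumes "a < 0" and [measurable]: "B \<in> sets lebesgue" and "0 < emeasure lebesgue B" "emeasure lebesgue B < \<infinity>"
    and [measurable]: "w \<in> borel_measurable lebesgue"
  shows "0 < avg B (\<lambda>x. enn_powr (ennreal (w x)) a)"
proof (rule ccontr)
  assume "\<not> ?thesis"
  then have "(\<integral>\<^sup>+x\<in>B. enn_powr (ennreal (w x)) a \<partial>lebesgue) = 0"
    using assms(3,4) by (auto simp: avg_def)
  then have "AE x in lebesgue. enn_powr (ennreal (w x)) a * indicator B x = 0"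
    by (subst (asm) nn_integral_0_iff_AE) auto
  moreover have "enn_powr (ennreal y) a \<noteq> 0" for y :: real
    using assms(1) by (cases "0 < y") (auto simp: enn_powr_def ennreal_neg)
  ultimately have "AE x in lebesgue. x \<notin> B"
    by (auto simp: indicator_def)
  then have "emeasure lebesgue B = 0"
    using AE_iff_measurable[of B lebesgue "\<lambda>x. x \<notin> B"] by auto
  then show False using assms(3) by simp
qed

text \<open>When \<open>\<nu>\<close> has positive mass on \<open>B\<close>, the bump condition forces every averaged negative
  power of a \<open>w i\<close> to be finite (none of these averages vanishes), so that each \<open>w i\<close> is
  positive almost everywhere on \<open>B\<close>; otherwise the claim is trivial.\<close>

lemma power_bump_local:
  fixes \<nu> :: "real ^ 'n \<Rightarrow> real" and f w :: "nat \<Rightarrow> real ^ 'n \<Rightarrow> real"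
  assumes P: "\<And>i. i \<in> I \<Longrightarrow> 1 < P i" and r: "1 < r" and p: "0 < p" and I: "finite I"
    and B [measurable]: "B \<in> sets lebesgue" and "0 < emeasure lebesgue B" and fin: "emeasure lebesgue B < \<infinity>"
    and f: "\<And>i. i \<in> I \<Longrightarrow> f i \<in> borel_measurable lebesgue"
    and w: "\<And>i. i \<in> I \<Longrightarrow> w i \<in> borel_measurable lebesgue" "\<And>i x. i \<in> I \<Longrightarrow> 0 \<le> w i x"
    and bump: "avg B (\<lambda>x. ennreal (\<nu> x)) *
        (\<Prod>i\<in>I. enn_powr (avg B (\<lambda>x. enn_powr (ennreal (w i x)) ((1 - conj_exp (P i)) * r)))
           (p / (conj_exp (P i) * r))) \<le> K" and K: "K < \<infinity>"
    and s: "\<And>i. s i = conj_exp (conj_exp (P i) * r)"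
    and t: "t \<le> (\<Prod>i\<in>I. avg B (\<lambda>x. ennreal \<bar>f i x\<bar>))"
  shows "enn_powr t p * avg B (\<lambda>x. ennreal (\<nu> x)) \<le>
    K * (\<Prod>i\<in>I. enn_powr (avg B (\<lambda>x. ennreal (\<bar>f i x\<bar> powr s i * w i x powr (s i / P i)))) (p / s i))"
proof (cases "avg B (\<lambda>x. ennreal (\<nu> x)) = 0")
  case False
  define W where "W i = avg B (\<lambda>x. enn_powr (ennreal (w i x)) ((1 - conj_exp (P i)) * r))" for i
  define A where "A i = avg B (\<lambda>x. ennreal (\<bar>f i x\<bar> powr s i * w i x powr (s i / P i)))" for i
  have exps: "0 < p / (conj_exp (P i) * r)" if "i \<in> I" for i
    using conj_exp_gt_1[OF P[OF that]] r p by auto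
  have W0: "W i \<noteq> 0" if i: "i \<in> I" for i
    unfolding W_def using avg_neg_power_pos[OF _ B _ fin w(1)[OF i], of "(1 - conj_exp (P i)) * r"]
      conj_exp_gt_1[OF P[OF i]] r assms(6) by (simp add: mult_less_0_iff zero_less_iff_neq_zero)
  have "(\<Prod>i\<in>I. enn_powr (W i) (p / (conj_exp (P i) * r))) \<noteq> top"
    using bump K False by (auto simp: W_def ennreal_mult_top top_unique)
  moreover have "(\<Prod>i\<in>I. enn_powr (W i) (p / (conj_exp (P i) * r))) \<noteq> 0"
    using I W0 exps by (simp add: enn_powr_eq_0_iff)
  ultimately have Wfin: "W i \<noteq> top" if "i \<in> I" for i
    using that I exps W0 unfolding ennreal_prod_eq_top by (auto simp: enn_powr_eq_top_iff enn_powr_eq_0_iff)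
  have "t \<le> (\<Prod>i\<in>I. enn_powr (A i) (1 / s i) * enn_powr (W i) (1 / (conj_exp (P i) * r)))"
  proof (rule order_trans[OF t], rule prod_mono_ennreal)
    fix i assume i: "i \<in> I"
    show "avg B (\<lambda>x. ennreal \<bar>f i x\<bar>) \<le> enn_powr (A i) (1 / s i) * enn_powr (W i) (1 / (conj_exp (P i) * r))"
      unfolding A_def W_def using i Wfin[OF i]
      by (intro avg_weighted_Holder P r B fin f w s) (auto simp: W_def less_top)
  qed
  \<comment> \<open>The power \<open>p\<close> gives the \<open>W i\<close> the exponents of the
    bump condition; together with the average of \<open>\<nu>\<close> they are then absorbed into
    \<open>K\<close>.\<close>
  then have "enn_powr t p \<le> enn_powr (\<Prod>i\<in>I. enn_powr (A i) (1 / s i) * enn_powr (W i) (1 / (conj_exp (P i) * r))) p"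
    using p by (intro enn_powr_mono) auto
  also have "\<dots> = (\<Prod>i\<in>I. enn_powr (A i) (p / s i)) * (\<Prod>i\<in>I. enn_powr (W i) (p / (conj_exp (P i) * r)))"
    using p by (simp add: enn_powr_prod enn_powr_mult enn_powr_powr prod.distrib)
  finally have "enn_powr t p * avg B (\<lambda>x. ennreal (\<nu> x)) \<le>
     (\<Prod>i\<in>I. enn_powr (A i) (p / s i)) * (\<Prod>i\<in>I. enn_powr (W i) (p / (conj_exp (P i) * r))) * avg B (\<lambda>x. ennreal (\<nu> x))"
    by (rule mult_right_mono) simp
  also have "\<dots> = (avg B (\<lambda>x. ennreal (\<nu> x)) * (\<Prod>i\<in>I. enn_powr (W i) (p / (conj_exp (P i) * r)))) * (\<Prod>i\<in>I. enn_powr (A i) (p / s i))"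
    by (simp add: ac_simps)
  also have "\<dots> \<le> K * (\<Prod>i\<in>I. enn_powr (A i) (p / s i))"
    using bump by (intro mult_right_mono) (auto simp: W_def)
  finally show ?thesis by (simp add: A_def)
qed simp

section \<open>Weighted measures of unions\<close>

text \<open>By Lindelof a countable subfamily has the same union. Its initial segments are finite
  with increasing unions, so continuity from below carries the uniform bound over.\<close>

lemma weight_measure_Union_le:
  fixes \<nu> :: "real ^ 'n \<Rightarrow> real"
  assumes \<nu> [measurable]: "\<nu> \<in> borel_measurable lebesgue" and op: "\<And>B. B \<in> \<G> \<Longrightarrow> open B"
    and le: "\<And>F. finite F \<Longrightarrow> F \<subseteq> \<G> \<Longrightarrow> c * weight_measure \<nu> (\<Union>F) \<le> D"
  shows "c * weight_measure \<nu> (\<Union>\<G>) \<le> D"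
proof -
  obtain \<G>' where \<G>': "\<G>' \<subseteq> \<G>" "countable \<G>'" "\<Union>\<G>' = \<Union>\<G>"
    using Lindelof[of \<G>] op by metis
  show ?thesis
  proof (cases "\<G>' = {}")
    case True
    then show ?thesis using le[of "{}"] \<G>'(3)[symmetric] by (simp only: True) simp
  next
    case False
    \<comment> \<open>The enumeration may repeat members when the subfamily is finite, which does
      not affect the unions.\<close>
    define S where "S n = from_nat_into \<G>' ` {..n}" for n
    have S: "finite (S n)" "S n \<subseteq> \<G>" for n
      using from_nat_into[OF False] \<G>'(1) by (auto simp: S_def)
    have meas: "\<Union>(S n) \<in> sets lebesgue" for n
    proof -
      have "open (\<Union>(S n))" using S(2) op by blast
      then show ?thesis by simp
    qed
    have "(\<Union>n. \<Union>(S n)) = \<Union>(range (from_nat_into \<G>'))"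
      by (auto simp: S_def)
    also have "\<dots> = \<Union>\<G>"
      using range_from_nat_into[OF False \<G>'(2)] \<G>'(3) by simp
    finally have U: "(\<Union>n. \<Union>(S n)) = \<Union>\<G>" .
    have "open (\<Union>\<G>)" using op by blast
    then have "\<Union>\<G> \<in> sets lebesgue" by simp
    then have "weight_measure \<nu> (\<Union>\<G>) = emeasure (density lebesgue (\<lambda>x. ennreal (\<nu> x))) (\<Union>n. \<Union>(S n))"
      unfolding U by (intro weight_measure_eq_emeasure \<nu>)
    also have "\<dots> = (SUP n. emeasure (density lebesgue (\<lambda>x. ennreal (\<nu> x))) (\<Union>(S n)))"
      using meas by (intro SUP_emeasure_incseq[symmetric] monoI Union_mono)
        (auto simp: S_def intro!: image_mono)
    also have "\<dots> = (SUP n. weight_measure \<nu> (\<Union>(S n)))"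
      using meas by (simp add: weight_measure_eq_emeasure)
    finally have "c * weight_measure \<nu> (\<Union>\<G>) = (SUP n. c * weight_measure \<nu> (\<Union>(S n)))"
      by (simp add: SUP_mult_left_ennreal)
    then show ?thesis using le S by (auto intro!: SUP_least)
  qed
qed

lemma sum_nn_integral_disjoint_le:
  assumes "finite F" "disjoint_family_on E F" "\<And>B. B \<in> F \<Longrightarrow> E B \<in> sets M" "h \<in> borel_measurable M"
  shows "(\<Sum>B\<in>F. \<integral>\<^sup>+x\<in>E B. h x \<partial>M) \<le> (\<integral>\<^sup>+x. h x \<partial>M)"
proof -
  have "(\<Sum>B\<in>F. \<integral>\<^sup>+x\<in>E B. h x \<partial>M) = (\<integral>\<^sup>+x. (\<Sum>B\<in>F. h x * indicator (E B) x) \<partial>M)"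
    using assms by (subst nn_integral_sum) auto
  also have "\<dots> = (\<integral>\<^sup>+x. h x * indicator (\<Union>(E ` F)) x \<partial>M)"
    by (simp add: sum_distrib_left[symmetric] indicator_UN_disjoint[OF assms(1,2)])
  also have "\<dots> \<le> (\<integral>\<^sup>+x. h x \<partial>M)"
    by (intro nn_integral_mono) (auto simp: indicator_def)
  finally show ?thesis .
qed

lemma weight_measure_Union_finite_le:
  assumes "w \<in> borel_measurable lebesgue" "finite F" "\<And>B. B \<in> F \<Longrightarrow> B \<in> sets lebesgue"
  shows "weight_measure w (\<Union>F) \<le> (\<Sum>B\<in>F. weight_measure w B)"
proof -
  have "\<Union>F \<in> sets lebesgue" using assms by auto
  moreover have "emeasure (density lebesgue (\<lambda>x. ennreal (w x))) (\<Union>B\<in>F. B)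
      \<le> (\<Sum>B\<in>F. emeasure (density lebesgue (\<lambda>x. ennreal (w x))) B)"
    using assms by (intro emeasure_subadditive_finite) auto
  ultimately show ?thesis
    using assms by (simp add: weight_measure_eq_emeasure)
qed

lemma weight_measure_eq_avg:
  assumes "0 < emeasure lebesgue B" "emeasure lebesgue B < \<infinity>"
  shows "weight_measure w B = avg B (\<lambda>x. ennreal (w x)) * emeasure lebesgue B"
  using assms by (simp add: weight_measure_def avg_def ennreal_divide_times mult_divide_eq_ennreal less_top zero_less_iff_neq_zero)

section \<open>The weak-type estimate for finitely many basis sets\<close>

text \<open>The estimate is kept in \<open>p\<close>-th powers, so that the contributions of the
  chosen sets can be added. Its constant does not depend on \<open>F\<close>, which permits the
  passage to the whole level set.\<close>

lemma weak_type_finite_union: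
  fixes \<B> :: "(real ^ 'n) set set" and P s :: "nat \<Rightarrow> real" and \<nu> :: "real ^ 'n \<Rightarrow> real"
    and w f :: "nat \<Rightarrow> real ^ 'n \<Rightarrow> real"
  assumes basis: "basis_of_sets \<B>" and I: "finite I"
    and P: "\<And>i. i \<in> I \<Longrightarrow> 1 < P i" and p: "0 < p" "1 / p = (\<Sum>i\<in>I. 1 / P i)"
    and \<nu>: "weight \<B> \<nu>" and w: "\<And>i. i \<in> I \<Longrightarrow> weight \<B> (w i)"
    and r: "1 < r" and s: "\<And>i. s i = conj_exp (conj_exp (P i) * r)"
    and K: "K < \<infinity>" "\<And>B. B \<in> \<B> \<Longrightarrow> avg B (\<lambda>x. ennreal (\<nu> x)) *
        (\<Prod>i\<in>I. enn_powr (avg B (\<lambda>x. enn_powr (ennreal (w i x)) ((1 - conj_exp (P i)) * r)))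
           (p / (conj_exp (P i) * r))) \<le> K"
    and L: "\<And>F G. F \<subseteq> \<B> \<Longrightarrow> G \<in> sets lebesgue \<Longrightarrow> weight_measure \<nu> G < \<infinity> \<Longrightarrow>
      (\<And>B. B \<in> F \<Longrightarrow> emeasure lebesgue B \<le> 2 * emeasure lebesgue (B \<inter> G)) \<Longrightarrow>
      weight_measure \<nu> (\<Union>F) \<le> L * weight_measure \<nu> G"
    and N: "\<And>i h. i \<in> I \<Longrightarrow> h \<in> borel_measurable lebesgue \<Longrightarrow>
      (\<integral>\<^sup>+x. enn_powr (ennreal \<bar>h x\<bar>) (P i / s i) \<partial>lebesgue) < \<infinity> \<Longrightarrow>
      (\<integral>\<^sup>+x. enn_powr (maximal \<B> h x) (P i / s i) \<partial>lebesgue)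
      \<le> N i * (\<integral>\<^sup>+x. enn_powr (ennreal \<bar>h x\<bar>) (P i / s i) \<partial>lebesgue)"
    and f: "\<And>i. i \<in> I \<Longrightarrow> f i \<in> weighted_Lp (P i) (w i)"
    and F: "finite F" "F \<subseteq> \<B>" "\<And>B. B \<in> F \<Longrightarrow> t \<le> (\<Prod>i\<in>I. avg B (\<lambda>y. ennreal \<bar>f i y\<bar>))"
  shows "enn_powr t p * weight_measure \<nu> (\<Union>F) \<le>
    L * (2 * K * (\<Prod>i\<in>I. enn_powr (N i) (p / P i))) *
    enn_powr (\<Prod>i\<in>I. wnorm (P i) (w i) (\<lambda>x. ennreal \<bar>f i x\<bar>)) p"
proof -
  have \<nu>m [measurable]: "\<nu> \<in> borel_measurable lebesgue" using \<nu> by (simp add: weight_def)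
  have wm [measurable]: "w i \<in> borel_measurable lebesgue" and w0: "0 \<le> w i x" if "i \<in> I" for i x
    using w[OF that] by (auto simp: weight_def)
  have fm [measurable]: "f i \<in> borel_measurable lebesgue" if "i \<in> I" for i
    using f[OF that] by (simp add: weighted_Lp_def)
  have s1: "1 < s i" if "i \<in> I" for i
    unfolding s using conj_exp_gt_1[OF P[OF that]] r by (intro conj_exp_gt_1) (simp add: less_1_mult)
  have B: "B \<in> sets lebesgue" "0 < emeasure lebesgue B" "emeasure lebesgue B < \<infinity>"
    "weight_measure \<nu> B < \<infinity>" if "B \<in> \<B>" for B
    using that basis emeasure_basis_pos[of B] \<nu> by (auto simp: basis_of_sets_def weight_def)
  \<comment> \<open>With this choice the power \<open>P i / s i\<close> of \<open>g i\<close> is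
    \<open>\<bar>f i\<bar> powr P i * w i\<close>, so an unweighted bound for \<open>g i\<close> is
    a weighted one for \<open>f i\<close>.\<close>
  define g where "g i x = \<bar>f i x\<bar> powr s i * w i x powr (s i / P i)" for i x
  have gm: "g i \<in> borel_measurable lebesgue" if "i \<in> I" for i
    unfolding g_def using fm[OF that] wm[OF that] by measurable
  have g0: "0 \<le> g i x" for i x by (simp add: g_def)
  note mm [measurable] = maximal_measurable[OF basis]
  define H where "H x = (\<Prod>i\<in>I. enn_powr (maximal \<B> (g i) x) (p / s i))" for x
  have Hm [measurable]: "H \<in> borel_measurable lebesgue"
    unfolding H_def by measurable
  define X where "X = (\<Prod>i\<in>I. wnorm (P i) (w i) (\<lambda>x. ennreal \<bar>f i x\<bar>))"
  have "F \<subseteq> sets lebesgue" "\<forall>B\<in>F. emeasure lebesgue B < \<infinity>"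
    using F(2) B by blast+
  from sparse_selection[OF F(1) this] obtain F' E where F': "F' \<subseteq> F" "disjoint_family_on E F'"
    and E: "\<And>B. B \<in> F' \<Longrightarrow> E B \<in> sets lebesgue" "\<And>B. B \<in> F' \<Longrightarrow> E B \<subseteq> B"
      "\<And>B. B \<in> F' \<Longrightarrow> emeasure lebesgue B \<le> 2 * emeasure lebesgue (E B)"
    and half: "\<And>B. B \<in> F \<Longrightarrow> emeasure lebesgue B \<le> 2 * emeasure lebesgue (B \<inter> \<Union>F')"
    by (elim exE conjE) (rule that; blast)
  have finF': "finite F'" using F'(1) F(1) finite_subset by blast
  have F'B: "B \<in> \<B>" if "B \<in> F'" for B using that F'(1) F(2) by auto
  have U: "weight_measure \<nu> (\<Union>F') \<le> (\<Sum>B\<in>F'. weight_measure \<nu> B)"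
    using F'B B finF' by (intro weight_measure_Union_finite_le) auto
  \<comment> \<open>The doubling property \<open>L\<close> is only available for a covering set of
    finite \<open>\<nu>\<close>-measure.\<close>
  have "(\<Sum>B\<in>F'. weight_measure \<nu> B) < \<infinity>"
    using F'B B finF' by auto
  with U have fin: "weight_measure \<nu> (\<Union>F') < \<infinity>" by (rule order.strict_trans1)
  have "\<Union>F' \<in> sets lebesgue" using F'B B(1) finF' by blast
  then have "weight_measure \<nu> (\<Union>F) \<le> L * weight_measure \<nu> (\<Union>F')"
    using fin half by (intro L F(2)) blast+
  also have "\<dots> \<le> L * (\<Sum>B\<in>F'. weight_measure \<nu> B)"
    using U by (rule mult_left_mono) simp
  finally have "enn_powr t p * weight_measure \<nu> (\<Union>F) \<le> enn_powr t p * (L * (\<Sum>B\<in>F'. weight_measure \<nu> B))"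
    by (rule mult_left_mono) simp
  also have "\<dots> = L * (\<Sum>B\<in>F'. enn_powr t p * weight_measure \<nu> B)"
    by (simp only: mult.left_commute[of _ L] sum_distrib_left[symmetric])
  finally have 1: "enn_powr t p * weight_measure \<nu> (\<Union>F) \<le> L * (\<Sum>B\<in>F'. enn_powr t p * weight_measure \<nu> B)" .
  have single: "enn_powr t p * weight_measure \<nu> B \<le> 2 * K * (\<integral>\<^sup>+x\<in>E B. H x \<partial>lebesgue)"
    if B': "B \<in> F'" for B
  proof -
    define A where "A = (\<Prod>i\<in>I. enn_powr (avg B (\<lambda>x. ennreal (g i x))) (p / s i))"
    have BB: "B \<in> \<B>" using F'B[OF B'] .
    have "enn_powr t p * avg B (\<lambda>x. ennreal (\<nu> x)) \<le> K * A"
      unfolding A_def g_def using F'(1) B'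
      by (intro power_bump_local[OF P r p(1) I B(1-3)[OF BB] fm wm w0 K(2)[OF BB] K(1) s] F(3)) auto
    then have "enn_powr t p * weight_measure \<nu> B \<le> K * A * emeasure lebesgue B"
      unfolding weight_measure_eq_avg[OF B(2,3)[OF BB]] mult.assoc[symmetric]
      by (rule mult_right_mono) simp
    \<comment> \<open>Sparseness enters here and is the origin of the factor 2. The constant
      \<open>A\<close> is then at most \<open>H\<close> at each point of \<open>E B\<close>, since
      every such point lies in \<open>B\<close>.\<close>
    also have "\<dots> \<le> K * A * (2 * emeasure lebesgue (E B))"
      using E(3)[OF B'] by (rule mult_left_mono) simp
    also have "\<dots> = 2 * K * (\<integral>\<^sup>+x. A * indicator (E B) x \<partial>lebesgue)"
      using E(1)[OF B'] by (simp add: nn_integral_cmult_indicator ac_simps)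
    also have "\<dots> \<le> 2 * K * (\<integral>\<^sup>+x\<in>E B. H x \<partial>lebesgue)"
    proof (intro mult_left_mono nn_integral_mono)
      fix x
      show "A * indicator (E B) x \<le> H x * indicator (E B) x"
      proof (cases "x \<in> E B")
        case True
        then have "x \<in> B" using E(2)[OF B'] by auto
        have "A \<le> H x"
          unfolding A_def H_def
        proof (intro prod_mono_ennreal enn_powr_mono)
          fix i assume "i \<in> I"
          then show "0 \<le> p / s i" using s1[of i] p(1) by simp
          show "avg B (\<lambda>x. ennreal (g i x)) \<le> maximal \<B> (g i) x"
            unfolding maximal_def using BB \<open>x \<in> B\<close> g0 by (intro SUP_upper2[of B]) auto
        qed
        then show ?thesis using True by simp
      qed simp
    qed simp
    finally show ?thesis .
  qed
  have "(\<Sum>B\<in>F'. enn_powr t p * weight_measure \<nu> B) \<le> (\<Sum>B\<in>F'. 2 * K * (\<integral>\<^sup>+x\<in>E B. H x \<partial>lebesgue))"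
    using single by (rule sum_mono)
  also have "\<dots> \<le> 2 * K * (\<integral>\<^sup>+x. H x \<partial>lebesgue)"
    unfolding sum_distrib_left[symmetric] using E(1)
    by (intro mult_left_mono sum_nn_integral_disjoint_le finF' F'(2)) auto
  finally have 2: "(\<Sum>B\<in>F'. enn_powr t p * weight_measure \<nu> B) \<le> 2 * K * (\<integral>\<^sup>+x. H x \<partial>lebesgue)" .
  \<comment> \<open>The exponent \<open>p / s i\<close> is split as
    \<open>(P i / s i) * (p / P i)\<close>: the first factor suits the maximal bound, and the
    numbers \<open>p / P i\<close> add up to 1, as Hoelder requires.\<close>
  have "(\<integral>\<^sup>+x. H x \<partial>lebesgue) =
      (\<integral>\<^sup>+x. (\<Prod>i\<in>I. enn_powr (enn_powr (maximal \<B> (g i) x) (P i / s i)) (p / P i)) \<partial>lebesgue)"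
    unfolding H_def enn_powr_powr using P by (intro nn_integral_cong prod.cong) force+
  also have "\<dots> \<le> (\<Prod>i\<in>I. enn_powr (\<integral>\<^sup>+x. enn_powr (maximal \<B> (g i) x) (P i / s i) \<partial>lebesgue) (p / P i))"
  proof (rule nn_integral_Holder_prod[OF I])
    show "0 < p / P i" if "i \<in> I" for i using P[OF that] p by simp
    have "(\<Sum>i\<in>I. p / P i) = p * (\<Sum>i\<in>I. 1 / P i)" by (simp add: sum_distrib_left)
    also have "\<dots> = p * (1 / p)" by (simp only: p(2))
    finally show "(\<Sum>i\<in>I. p / P i) = 1" using p(1) by simp
  qed measurable
  also have "\<dots> \<le> (\<Prod>i\<in>I. enn_powr (N i) (p / P i) * enn_powr (wnorm (P i) (w i) (\<lambda>x. ennreal \<bar>f i x\<bar>)) p)"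
  proof (rule prod_mono_ennreal)
    fix i assume i: "i \<in> I"
    have Pi: "0 < P i" "0 < s i" using P[OF i] s1[OF i] by auto
    have int: "enn_powr (ennreal \<bar>g i x\<bar>) (P i / s i) = enn_powr (ennreal \<bar>f i x\<bar>) (P i) * ennreal (w i x)" for x
      using Pi w0[OF i] by (simp add: g_def enn_powr_ennreal_nonneg powr_mult powr_powr flip: ennreal_mult)
    have "(\<integral>\<^sup>+x. enn_powr (ennreal \<bar>g i x\<bar>) (P i / s i) \<partial>lebesgue) < \<infinity>"
      unfolding int using f[OF i] Pi
      by (auto simp: weighted_Lp_def wnorm_def enn_powr_eq_top_iff simp flip: less_top)
    from N[OF i gm[OF i] this]
    have "(\<integral>\<^sup>+x. enn_powr (maximal \<B> (g i) x) (P i / s i) \<partial>lebesgue) \<le>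
        N i * (\<integral>\<^sup>+x. enn_powr (ennreal \<bar>f i x\<bar>) (P i) * ennreal (w i x) \<partial>lebesgue)"
      unfolding int .
    then have "enn_powr (\<integral>\<^sup>+x. enn_powr (maximal \<B> (g i) x) (P i / s i) \<partial>lebesgue) (p / P i) \<le>
        enn_powr (N i * (\<integral>\<^sup>+x. enn_powr (ennreal \<bar>f i x\<bar>) (P i) * ennreal (w i x) \<partial>lebesgue)) (p / P i)"
      using Pi p by (intro enn_powr_mono) auto
    also have "\<dots> = enn_powr (N i) (p / P i) * enn_powr (wnorm (P i) (w i) (\<lambda>x. ennreal \<bar>f i x\<bar>)) (P i * (p / P i))"
      using Pi p by (subst wnorm_powr) (auto simp: enn_powr_mult)
    finally show "enn_powr (\<integral>\<^sup>+x. enn_powr (maximal \<B> (g i) x) (P i / s i) \<partial>lebesgue) (p / P i) \<le>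
        enn_powr (N i) (p / P i) * enn_powr (wnorm (P i) (w i) (\<lambda>x. ennreal \<bar>f i x\<bar>)) p"
      using Pi by simp
  qed
  also have "\<dots> = (\<Prod>i\<in>I. enn_powr (N i) (p / P i)) * enn_powr X p"
    using p by (simp add: X_def enn_powr_prod prod.distrib)
  finally have 3: "(\<integral>\<^sup>+x. H x \<partial>lebesgue) \<le> (\<Prod>i\<in>I. enn_powr (N i) (p / P i)) * enn_powr X p" .
  have "enn_powr t p * weight_measure \<nu> (\<Union>F) \<le> L * (2 * K * ((\<Prod>i\<in>I. enn_powr (N i) (p / P i)) * enn_powr X p))"
    by (rule order_trans[OF 1 mult_left_mono[OF order_trans[OF 2 mult_left_mono[OF 3]]]]) auto
  then show ?thesis by (simp add: X_def mult.assoc)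
qed

section \<open>From finite unions to the level sets of the multilinear maximal function\<close>

theorem theorem2p3:
  fixes \<B> :: "(real ^ 'n) set set"
    and m :: nat
    and P :: "nat \<Rightarrow> real"
    and p :: real
    and \<nu> :: "real ^ 'n \<Rightarrow> real"
    and w :: "nat \<Rightarrow> real ^ 'n \<Rightarrow> real"
  assumes "muckenhoupt_basis \<B>"
    and "m \<ge> 1"
    and "\<And>i. i \<in> {1..m} \<Longrightarrow> 1 < P i"
    and "1 / p = (\<Sum>i=1..m. 1 / P i)"
    and "weight \<B> \<nu>"
    and "\<And>i. i \<in> {1..m} \<Longrightarrow> weight \<B> (w i)"
    and "power_bump \<B> m P p \<nu> w"
  shows "multi_maximal_weak_bounded \<B> m P p \<nu> w"
proof -
  have "0 < (\<Sum>i=1..m. 1 / P i)"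
    using assms(2,3) by (intro sum_pos) (auto intro: less_trans[OF zero_less_one])
  then have p: "0 < p" unfolding assms(4)[symmetric] by simp
  have basis: "basis_of_sets \<B>" using assms(1) by (simp add: muckenhoupt_basis_def)
  define bump where "bump r B = avg B (\<lambda>x. ennreal (\<nu> x)) *
      (\<Prod>i=1..m. enn_powr (avg B (\<lambda>x. enn_powr (ennreal (w i x)) ((1 - conj_exp (P i)) * r)))
         (p / (conj_exp (P i) * r)))" for r B
  obtain r where r: "1 < r" "(SUP B\<in>\<B>. bump r B) < \<infinity>" and \<nu>: "\<nu> \<in> A_infinity \<B>"
    using assms(7) unfolding power_bump_def bump_def by auto
  define K where "K = (SUP B\<in>\<B>. bump r B)"
  have K: "K < \<infinity>" "\<And>B. B \<in> \<B> \<Longrightarrow> bump r B \<le> K"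
    using r(2) by (auto simp: K_def intro: SUP_upper)
  define s where "s i = conj_exp (conj_exp (P i) * r)" for i
  obtain L :: real where L: "\<And>F G. F \<subseteq> \<B> \<Longrightarrow> G \<in> sets lebesgue \<Longrightarrow> weight_measure \<nu> G < \<infinity> \<Longrightarrow>
      (\<And>B. B \<in> F \<Longrightarrow> emeasure lebesgue B \<le> 2 * emeasure lebesgue (B \<inter> G)) \<Longrightarrow>
      weight_measure \<nu> (\<Union>F) \<le> ennreal L * weight_measure \<nu> G"
    using A_infinity_enlarge[OF assms(1) \<nu>] by metis
  have "\<exists>N::real. \<forall>h\<in>borel_measurable lebesgue.
      (\<integral>\<^sup>+x. enn_powr (ennreal \<bar>h x\<bar>) (P i / s i) \<partial>lebesgue) < \<infinity> \<longrightarrow>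
      (\<integral>\<^sup>+x. enn_powr (maximal \<B> h x) (P i / s i) \<partial>lebesgue)
      \<le> ennreal N * (\<integral>\<^sup>+x. enn_powr (ennreal \<bar>h x\<bar>) (P i / s i) \<partial>lebesgue)" if i: "i \<in> {1..m}" for i
  proof -
    have "1 < conj_exp (P i)" using conj_exp_gt_1[OF assms(3)[OF i]] .
    then have "1 < conj_exp (P i) * r" "conj_exp (P i) < conj_exp (P i) * r"
      using r(1) by (simp_all add: less_1_mult)
    \<comment> \<open>Conjugation reverses order: \<open>s i\<close> is conjugate to
      \<open>conj_exp (P i) * r\<close>, and \<open>P i\<close> to the smaller
      \<open>conj_exp (P i)\<close>. The strict gap, due to \<open>r > 1\<close>, makes
      \<open>P i / s i > 1\<close>, so the unweighted strong-type bound applies.\<close>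
    then have "1 < s i" "s i < P i"
      using conj_exp_strict_antimono[OF \<open>1 < conj_exp (P i)\<close>] conj_exp_conj_exp[OF assms(3)[OF i]]
      by (auto simp: s_def intro: conj_exp_gt_1)
    then have q: "1 < P i / s i" by simp
    then have "0 < P i / s i" by simp
    from maximal_boundedE[OF maximal_bounded_unweighted[OF assms(1) q] this] show ?thesis
      by (simp only: ennreal_1 mult_1_right) metis
  qed
  then obtain N :: "nat \<Rightarrow> real" where N: "\<And>i h. i \<in> {1..m} \<Longrightarrow> h \<in> borel_measurable lebesgue \<Longrightarrow>
      (\<integral>\<^sup>+x. enn_powr (ennreal \<bar>h x\<bar>) (P i / s i) \<partial>lebesgue) < \<infinity> \<Longrightarrow>
      (\<integral>\<^sup>+x. enn_powr (maximal \<B> h x) (P i / s i) \<partial>lebesgue)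
      \<le> ennreal (N i) * (\<integral>\<^sup>+x. enn_powr (ennreal \<bar>h x\<bar>) (P i / s i) \<partial>lebesgue)"
    by metis
  \<comment> \<open>\<open>D\<close> is the constant for the \<open>p\<close>-th powers; it is
    finite, and its \<open>p\<close>-th root is the constant \<open>C\<close> of the claim.\<close>
  define D where "D = ennreal L * (2 * K * (\<Prod>i=1..m. enn_powr (ennreal (N i)) (p / P i)))"
  have "enn_powr (ennreal (N i)) (p / P i) \<noteq> top" if "i \<in> {1..m}" for i
    using assms(3)[OF that] p by (subst enn_powr_eq_top_iff) auto
  then have "D \<noteq> top"
    using K(1) by (auto simp: D_def ennreal_mult_eq_top_iff ennreal_prod_eq_top)
  then have "enn_powr D (1 / p) \<noteq> top"
    using p by (simp add: enn_powr_eq_top_iff)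
  then obtain C where C: "enn_powr D (1 / p) = ennreal C"
    by (cases "enn_powr D (1 / p)") auto
  have "ennreal t * enn_powr (weight_measure \<nu> {x. ennreal t < multi_maximal \<B> m f x}) (1 / p)
      \<le> ennreal C * (\<Prod>i=1..m. wnorm (P i) (w i) (\<lambda>x. ennreal \<bar>f i x\<bar>))"
    if f: "\<And>i. i \<in> {1..m} \<Longrightarrow> f i \<in> weighted_Lp (P i) (w i)" for f t
  proof -
    define X where "X = (\<Prod>i=1..m. wnorm (P i) (w i) (\<lambda>x. ennreal \<bar>f i x\<bar>))"
    define \<G> where "\<G> = {B\<in>\<B>. ennreal t < (\<Prod>i=1..m. avg B (\<lambda>y. ennreal \<bar>f i y\<bar>))}"
    have level: "{x. ennreal t < multi_maximal \<B> m f x} = \<Union>\<G>"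
      unfolding multi_maximal_def \<G>_def by (rule SUP_containing_gt)
    have "enn_powr (ennreal t) p * weight_measure \<nu> (\<Union>\<G>) \<le> D * enn_powr X p"
    proof (rule weight_measure_Union_le)
      show "\<nu> \<in> borel_measurable lebesgue" using assms(5) by (simp add: weight_def)
      show "open B" if "B \<in> \<G>" for B using that basis by (auto simp: \<G>_def basis_of_sets_def)
      fix F assume "finite F" "F \<subseteq> \<G>"
      then show "enn_powr (ennreal t) p * weight_measure \<nu> (\<Union>F) \<le> D * enn_powr X p"
        unfolding D_def X_def
        by (intro weak_type_finite_union[where r = r and s = s and \<B> = \<B>] basis assms p r K(1)
            K(2)[unfolded bump_def] L N f s_def) (auto simp: \<G>_def less_imp_le)
    qed
    \<comment> \<open>Taking \<open>p\<close>-th roots is monotone and multiplicative, as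
      \<open>1 / p\<close> is positive; \<open>p\<close> itself may be below 1.\<close>
    then have "enn_powr (enn_powr (ennreal t) p * weight_measure \<nu> (\<Union>\<G>)) (1 / p) \<le> enn_powr (D * enn_powr X p) (1 / p)"
      using p by (intro enn_powr_mono) auto
    then show ?thesis
      unfolding X_def[symmetric] using p by (simp add: level enn_powr_mult enn_powr_powr C)
  qed
  then show ?thesis
    unfolding multi_maximal_weak_bounded_def by (intro exI[of _ C] allI impI SUP_least) auto
qed

end
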